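(* If $R$ is a commutative Bézout domain with the $IP_2$ property, then every $2\times 2$ invertible matrix over $R$ is a product of elementary matrices and diagonal matrices with invertible diagonal entries.
   Context: A commutative Bézout domain is a commutative integral domain in which every finitely generated ideal is principal. A $2\times 2$ matrix over $R$ is singular if it has nonzero left annihilator and nonzero right annihilator in $M_2(R)$. A ring $R$ has the $IP_2$ property if every $2\times2$ singular matrix over $R$ is a product of idempotent matrices. A $2\times2$ matrix is elementary if it is of the form $I_2+ce_{ij}$ with $c\in R$ and $i\neq j$. *)

theory Defs
  imports "HOL-Analysis.Analysis"
begin

lemma module_times: "module ((*) :: 'a::comm_ring_1 \<Rightarrow> 'a \<Rightarrow> 'a)"
  by unfold_locales (auto simp: algebra_simps)

text \<open>
  Ideals of a commutative ring are its submodules, so the ideal generated by a set is its span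
  in the ring regarded as a module over itself.
\<close>

definition ideal_generated_by :: "'a::comm_ring_1 set \<Rightarrow> 'a set" where
  "ideal_generated_by S = module.span (*) S"

text \<open>
  Ring properties are predicates on the type of ring elements; the domain axioms
  come from the class \<^class>\<open>idom\<close>.
\<close>

definition bezout_domain :: "'a::idom itself \<Rightarrow> bool" where
  "bezout_domain _ \<longleftrightarrow>
    (\<forall>S :: 'a set. finite S \<longrightarrow> (\<exists>d. ideal_generated_by S = ideal_generated_by {d}))"

definition singular_matrix :: "'a::ring_1^2^2 \<Rightarrow> bool" where
  "singular_matrix A \<longleftrightarrow>
    (\<exists>B :: 'a^2^2. B \<noteq> 0 \<and> B ** A = 0) \<and> (\<exists>C :: 'a^2^2. C \<noteq> 0 \<and> A ** C = 0)"

definition idempotent_matrix :: "'a::ring_1^2^2 \<Rightarrow> bool" where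
  "idempotent_matrix A \<longleftrightarrow> A ** A = A"

definition elementary_matrix :: "'a::ring_1^2^2 \<Rightarrow> bool" where
  "elementary_matrix A \<longleftrightarrow>
    (\<exists>c i j. i \<noteq> j \<and> A = mat 1 + (\<chi> k l. if k = i \<and> l = j then c else 0))"

definition invertible_diagonal_matrix :: "'a::comm_ring_1^2^2 \<Rightarrow> bool" where
  "invertible_diagonal_matrix A \<longleftrightarrow>
    (\<forall>i j. i \<noteq> j \<longrightarrow> A $ i $ j = 0) \<and> (\<forall>i. A $ i $ i dvd 1)"

definition is_product_of :: "('a::ring_1^2^2 \<Rightarrow> bool) \<Rightarrow> 'a^2^2 \<Rightarrow> bool" where
  "is_product_of P A \<longleftrightarrow> (\<exists>Ms. (\<forall>M \<in> set Ms. P M) \<and> A = foldr (**) Ms (mat 1))"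

definition IP2 :: "'a::ring_1 itself \<Rightarrow> bool" where
  "IP2 _ \<longleftrightarrow>
    (\<forall>A :: 'a^2^2. singular_matrix A \<longrightarrow> is_product_of idempotent_matrix A)"

end

theory Submission
  imports Defs
begin

text \<open>
  A row \<open>w\<close> over \<open>R\<close> is unimodular if its entries generate the unit ideal; this is expressed below
  as \<open>w v* Z = axis 1 1\<close> for some matrix \<open>Z\<close>, so that matrix algebra alone transports it.
  Call \<open>w\<close> reducible if \<open>w = axis 1 1 v* G\<close> for some \<open>G\<close> in \<open>GE\<^sub>2(R)\<close>, the group generated by the
  elementary and the invertible diagonal matrices.

  An invertible matrix lies in \<open>GE\<^sub>2(R)\<close> as soon as its first row is reducible: dividing by \<open>G\<close>
  leaves a lower triangular matrix with first row \<open>(1, 0)\<close>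
  (\<open>GE2_if_first_row_e1\<close>). The first row \<open>(a, b)\<close> is unimodular, and the matrix with rows \<open>(a, b)\<close>
  and \<open>(0, 0)\<close> is singular, hence a product \<open>E\<^sub>1 \<dots> E\<^sub>k\<close> of idempotents, so
  \<open>(a, b) = (1, 0) E\<^sub>1 \<dots> E\<^sub>k\<close>. All the intermediate rows \<open>(1, 0) E\<^sub>1 \<dots> E\<^sub>i\<close> are unimodular because
  the last one is.
  It remains to see that applying an idempotent \<open>E\<close> to a reducible row, with unimodular result,
  gives a reducible row. Conjugating \<open>E\<close> by \<open>G\<close> reduces this to the row \<open>(1, 0)\<close>, that is, to the
  first row \<open>(p, q)\<close> of an idempotent. When \<open>(p, q)\<close> is unimodular, it has the form
  \<open>(1 - t q, q)\<close> (\<open>idempotent_unimodular_first_row\<close>), and such a row is reached from \<open>(1, 0)\<close> by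
  two elementary column operations.
\<close>

section \<open>The group generated by elementary and invertible diagonal matrices\<close>

lemma is_product_of_one: "is_product_of P (mat 1)"
  unfolding is_product_of_def by (rule exI[of _ "[]"]) simp

lemma is_product_of_single:
  assumes "P A" shows "is_product_of P A"
  unfolding is_product_of_def
  by (rule exI[of _ "[A]"]) (simp add: assms)

lemma is_product_of_mult:
  assumes "is_product_of P A" "is_product_of P B"
  shows "is_product_of P (A ** B)"
proof -
  obtain Ms Ns where
    "\<forall>M \<in> set Ms. P M" "A = foldr (**) Ms (mat 1)"
    "\<forall>M \<in> set Ns. P M" "B = foldr (**) Ns (mat 1)"
    using assms unfolding is_product_of_def by blast
  moreover have "foldr (**) Ms (mat 1) ** C = foldr (**) Ms C" for C :: "'a^2^2"
    by (induction Ms) (simp_all add: matrix_mul_assoc[symmetric])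
  ultimately show ?thesis
    unfolding is_product_of_def by (intro exI[of _ "Ms @ Ns"]) auto
qed

abbreviation GE2_generator :: "'a::idom^2^2 \<Rightarrow> bool" where
  "GE2_generator M \<equiv> elementary_matrix M \<or> invertible_diagonal_matrix M"

abbreviation GE2 :: "'a::idom^2^2 \<Rightarrow> bool" where
  "GE2 \<equiv> is_product_of (\<lambda>M. GE2_generator M)"

lemma elementary_2_cases:
  assumes "elementary_matrix (A :: 'a::idom^2^2)"
  obtains c where "A = vector [vector [1, c], vector [0, 1]]"
        | c where "A = vector [vector [1, 0], vector [c, 1]]"
proof -
  obtain c i j where *: "i \<noteq> j" "A = mat 1 + (\<chi> k l. if k = i \<and> l = j then c else 0)"
    using assms unfolding elementary_matrix_def by blast
  consider "i = 1" "j = 2" | "i = 2" "j = 1"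
    using exhaust_2[of i] exhaust_2[of j] *(1) by blast
  then show ?thesis
    using * that[of c]
    by cases (auto simp: vec_eq_iff forall_2 mat_def)
qed

lemma elementary_upper: "elementary_matrix (vector [vector [1, c], vector [0, 1]] :: 'a::idom^2^2)"
  unfolding elementary_matrix_def
  by (rule exI[of _ c], rule exI[of _ 1], rule exI[of _ 2])
     (simp add: vec_eq_iff forall_2 mat_def)

lemma elementary_lower: "elementary_matrix (vector [vector [1, 0], vector [c, 1]] :: 'a::idom^2^2)"
  unfolding elementary_matrix_def
  by (rule exI[of _ c], rule exI[of _ 2], rule exI[of _ 1])
     (simp add: vec_eq_iff forall_2 mat_def)

lemmas matrix_2_simps = vec_eq_iff forall_2 matrix_matrix_mult_def mat_def sum_2

lemma GE2_generator_inverse: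
  assumes "GE2_generator A"
  obtains B where "GE2_generator B" "A ** B = mat 1" "B ** A = mat 1"
  using assms
proof
  assume "elementary_matrix A"
  then show thesis
  proof (cases rule: elementary_2_cases)
    case (1 c)
    then show thesis
      using that[of "vector [vector [1, - c], vector [0, 1]]"] elementary_upper[of "- c"]
      by (simp add: matrix_2_simps)
  next
    case (2 c)
    then show thesis
      using that[of "vector [vector [1, 0], vector [- c, 1]]"] elementary_lower[of "- c"]
      by (simp add: matrix_2_simps)
  qed
next
  assume "invertible_diagonal_matrix A"
  then have A: "A $ 1 $ 2 = 0" "A $ 2 $ 1 = 0" and "A $ 1 $ 1 dvd 1" "A $ 2 $ 2 dvd 1"
    by (simp_all add: invertible_diagonal_matrix_def)
  then obtain x y where xy: "1 = A $ 1 $ 1 * x" "1 = A $ 2 $ 2 * y"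
    by (auto elim!: dvdE)
  let ?B = "vector [vector [x, 0], vector [0, y]] :: 'a^2^2"
  have "x dvd 1" "y dvd 1"
    by (metis xy(1) dvd_triv_right, metis xy(2) dvd_triv_right)
  then have "invertible_diagonal_matrix ?B"
    by (simp add: invertible_diagonal_matrix_def forall_2)
  then show thesis
    using that[of ?B] A xy by (simp add: matrix_2_simps mult.commute)
qed

lemma GE2_inverse:
  assumes "GE2 A"
  obtains B where "GE2 B" "A ** B = mat 1" "B ** A = mat 1"
proof -
  obtain Ms where "\<forall>M \<in> set Ms. GE2_generator M" "A = foldr (**) Ms (mat 1)"
    using assms unfolding is_product_of_def by blast
  then have "\<exists>B. GE2 B \<and> A ** B = mat 1 \<and> B ** A = mat 1"
  proof (induction Ms arbitrary: A)
    case Nil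
    then show ?case
      using is_product_of_one by (auto intro!: exI[of _ "mat 1"])
  next
    case (Cons M Ms)
    define P where "P = foldr (**) Ms (mat 1)"
    obtain N where N: "GE2 N" "P ** N = mat 1" "N ** P = mat 1"
      using Cons.IH[of P] Cons.prems by (auto simp: P_def)
    obtain L where L: "GE2_generator L" "M ** L = mat 1" "L ** M = mat 1"
      using GE2_generator_inverse Cons.prems by (metis list.set_intros(1))
    have "GE2 (N ** L)"
      using L(1) by (rule is_product_of_mult[OF N(1) is_product_of_single])
    moreover have "(M ** P) ** (N ** L) = M ** (P ** N) ** L"
      "(N ** L) ** (M ** P) = N ** (L ** M) ** P"
      by (simp_all only: matrix_mul_assoc)
    moreover have "A = M ** P"
      using Cons.prems by (simp add: P_def)
    ultimately show ?case
      using N L by (intro exI[of _ "N ** L"]) simp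
  qed
  then show thesis
    using that by blast
qed

text \<open>
  An inverse of such an \<open>A\<close> also has first row \<open>(1, 0)\<close>, so the other diagonal entry of \<open>A\<close> is a
  unit and \<open>A\<close> is an elementary matrix times a diagonal one.
\<close>

lemma GE2_if_first_row_e1:
  assumes "A ** S = mat 1" "A $ 1 = axis 1 1"
  shows "GE2 (A :: 'a::idom^2^2)"
proof -
  define L D :: "'a^2^2"
    where "L = vector [vector [1, 0], vector [A $ 2 $ 1, 1]]"
      and "D = vector [vector [1, 0], vector [0, A $ 2 $ 2]]"
  have row: "A $ 1 $ 1 = 1" "A $ 1 $ 2 = 0"
    by (simp_all add: assms(2) axis_def)
  then have "A $ 2 $ 2 * S $ 2 $ 2 = 1"
    using assms(1) by (auto simp: matrix_2_simps)
  then have "A $ 2 $ 2 dvd 1"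
    by (metis dvd_triv_left)
  then have "invertible_diagonal_matrix D"
    by (simp add: D_def invertible_diagonal_matrix_def forall_2)
  moreover have "elementary_matrix L"
    unfolding L_def by (rule elementary_lower)
  moreover have "A = L ** D"
    using row by (simp add: L_def D_def matrix_2_simps)
  ultimately show ?thesis
    by (auto intro: is_product_of_mult is_product_of_single)
qed

section \<open>Reducible rows and idempotent matrices\<close>

lemma axis_one_vector_matrix_mult:
  "axis 1 1 v* A = (A :: 'a::idom^2^2) $ 1"
  by (simp add: vec_eq_iff vector_matrix_mult_def axis_def forall_2 sum_2)

text \<open>
  Write \<open>p, q, r, s\<close> for the entries of \<open>E\<close> and let \<open>p x + q y = 1\<close>. If \<open>q = 0\<close> then \<open>p\<close> is a unit
  and an idempotent, hence \<open>1\<close>. Otherwise cancelling \<open>q\<close> in \<open>p q + q s = q\<close> gives trace \<open>1\<close>, so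
  \<open>p s = q r\<close>; the second row is then \<open>t = r x + s y\<close> times the first, and \<open>s = t q\<close>.
\<close>

lemma idempotent_unimodular_first_row:
  fixes E :: "'a::idom^2^2"
  assumes "idempotent_matrix E" "(E $ 1) v* Z = axis 1 1"
  obtains t where "E $ 1 $ 1 = 1 - t * E $ 1 $ 2"
proof -
  define p q r s x y
    where "p = E $ 1 $ 1" "q = E $ 1 $ 2" "r = E $ 2 $ 1" "s = E $ 2 $ 2"
      and "x = Z $ 1 $ 1" "y = Z $ 2 $ 1"
  note defs = this
  have pp: "p * p + q * r = p" and pq: "p * q + q * s = q"
    using assms(1) by (simp_all add: defs idempotent_matrix_def matrix_2_simps)
  have unimodular: "p * x + q * y = 1"
    using assms(2)
    by (simp add: defs vec_eq_iff forall_2 vector_matrix_mult_def sum_2 axis_def mult.commute)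
  have "\<exists>t. p = 1 - t * q"
  proof (cases "q = 0")
    case True
    then have "p = 1"
      using pp unimodular by auto
    then show ?thesis
      using True by simp
  next
    case False
    have "q * (p + s) = q * 1"
      using pq by (simp add: algebra_simps)
    then have s: "p + s = 1"
      using False by (metis mult_left_cancel)
    have "p * p + q * r = p * (p + s)"
      using pp s by simp
    then have "r * q = s * p"
      by (simp add: algebra_simps)
    then have "(r * x + s * y) * q = s * (p * x + q * y)"
      by algebra
    then show ?thesis
      using s unimodular by (intro exI[of _ "r * x + s * y"]) (simp add: algebra_simps)
  qed
  then show thesis
    using that by (auto simp: defs)
qed

lemma row_one_minus_mult_reducible:
  fixes w :: "'a::idom^2"
  assumes "w $ 1 = 1 - t * w $ 2"
  obtains G where "GE2 G" "w = axis 1 1 v* G"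
proof -
  define U L :: "'a^2^2"
    where "U = vector [vector [1, w $ 2], vector [0, 1]]"
      and "L = vector [vector [1, 0], vector [- t, 1]]"
  have "GE2 (U ** L)"
    unfolding U_def L_def
    by (intro is_product_of_mult is_product_of_single disjI1 elementary_upper elementary_lower)
  moreover have "w = axis 1 1 v* (U ** L)"
    using assms by (simp add: axis_one_vector_matrix_mult U_def L_def matrix_2_simps mult.commute)
  ultimately show thesis
    using that by blast
qed

text \<open>
  With \<open>w = axis 1 1 v* G\<close>, the row \<open>w v* E\<close> is the first row of the idempotent \<open>G E G\<inverse>\<close>, followed
  by \<open>G\<close>; that first row is unimodular because \<open>w v* E\<close> is.
\<close>

lemma reducible_row_times_idempotent:
  fixes w :: "'a::idom^2"
  assumes "GE2 G" "w = axis 1 1 v* G" "idempotent_matrix E" "(w v* E) v* Z = axis 1 1"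
  obtains K where "GE2 K" "w v* E = axis 1 1 v* K"
proof -
  obtain H where H: "G ** H = mat 1" "H ** G = mat 1"
    using GE2_inverse[OF assms(1)] by blast
  define F where "F = G ** E ** H"
  have "F ** F = G ** E ** (H ** G) ** E ** H"
    by (simp only: F_def matrix_mul_assoc)
  also have "\<dots> = G ** (E ** E) ** H"
    by (simp add: H matrix_mul_assoc)
  finally have F: "idempotent_matrix F"
    using assms(3) by (simp add: idempotent_matrix_def F_def)
  have "F ** G = G ** E ** (H ** G)"
    by (simp only: F_def matrix_mul_assoc)
  then have wE: "w v* E = (F $ 1) v* G"
    by (simp add: H assms(2) vector_matrix_mul_assoc flip: axis_one_vector_matrix_mult)
  then have "(F $ 1) v* (G ** Z) = axis 1 1"
    using assms(4) by (simp add: vector_matrix_mul_assoc)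
  then obtain t where "F $ 1 $ 1 = 1 - t * F $ 1 $ 2"
    using idempotent_unimodular_first_row[OF F] by blast
  then obtain K where "GE2 K" "F $ 1 = axis 1 1 v* K"
    using row_one_minus_mult_reducible[of "F $ 1"] by blast
  then show thesis
    using that[of "K ** G"] wE assms(1) by (simp add: vector_matrix_mul_assoc is_product_of_mult)
qed

lemma reducible_row_times_idempotents:
  fixes w :: "'a::idom^2"
  assumes "\<forall>E \<in> set Es. idempotent_matrix E"
    and "GE2 G" "w = axis 1 1 v* G"
    and "(w v* foldr (**) Es (mat 1)) v* Z = axis 1 1"
  shows "\<exists>K. GE2 K \<and> w v* foldr (**) Es (mat 1) = axis 1 1 v* K"
  using assms
proof (induction Es arbitrary: w G)
  case Nil
  then show ?case
    by (auto simp: vector_matrix_mul_rid)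
next
  case (Cons E Es)
  define P where "P = foldr (**) Es (mat 1)"
  have split: "w v* foldr (**) (E # Es) (mat 1) = (w v* E) v* P"
    by (simp add: P_def vector_matrix_mul_assoc)
  have "(w v* E) v* (P ** Z) = axis 1 1"
    using Cons.prems(4) unfolding split by (simp add: vector_matrix_mul_assoc matrix_mul_assoc)
  moreover have idempotents: "idempotent_matrix E" "\<forall>E \<in> set Es. idempotent_matrix E"
    using Cons.prems(1) by simp_all
  ultimately obtain K where K: "GE2 K" "w v* E = axis 1 1 v* K"
    using reducible_row_times_idempotent[OF Cons.prems(2,3)] by blast
  have "((w v* E) v* P) v* Z = axis 1 1"
    using Cons.prems(4) unfolding split .
  then show ?case
    unfolding split P_def by (rule Cons.IH[OF idempotents(2) K])
qed

section \<open>Invertible matrices over a domain with singular matrices products of idempotents\<close>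

text \<open>
  The right annihilator comes from the column \<open>(b, - a)\<close>, which is orthogonal to the row \<open>(a, b)\<close>.
\<close>

lemma singular_matrix_second_row_zero:
  fixes w :: "'a::idom^2"
  assumes "w \<noteq> 0"
  shows "singular_matrix (vector [w, 0] :: 'a^2^2)"
  unfolding singular_matrix_def
proof
  let ?M = "vector [w, 0] :: 'a^2^2"
  let ?B = "vector [vector [0, 0], vector [0, 1]] :: 'a^2^2"
  show "\<exists>B :: 'a^2^2. B \<noteq> 0 \<and> B ** ?M = 0"
    by (rule exI[of _ ?B]) (simp add: matrix_2_simps)
  let ?C = "vector [vector [w $ 2, 0], vector [- w $ 1, 0]] :: 'a^2^2"
  show "\<exists>C :: 'a^2^2. C \<noteq> 0 \<and> ?M ** C = 0"
    using assms by (intro exI[of _ ?C]) (auto simp: matrix_2_simps mult.commute)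
qed

theorem corollary21:
  fixes A :: "'a::idom^2^2"
  assumes "bezout_domain TYPE('a)"
    and "IP2 TYPE('a)"
    and "invertible A"
  shows "is_product_of (\<lambda>M. elementary_matrix M \<or> invertible_diagonal_matrix M) A"
proof -
  obtain B where B: "A ** B = mat 1"
    using assms(3) unfolding invertible_def by blast
  have unimodular: "(A $ 1) v* B = axis 1 1"
    by (simp add: vector_matrix_mul_assoc B vector_matrix_mul_rid flip: axis_one_vector_matrix_mult)
  then have "A $ 1 \<noteq> 0"
    by (metis axis_eq_0_iff vector_matrix_mult_0 zero_neq_one)
  then obtain Es where Es: "\<forall>E \<in> set Es. idempotent_matrix E"
    and M: "vector [A $ 1, 0] = foldr (**) Es (mat 1)"
    using assms(2) singular_matrix_second_row_zero[of "A $ 1"]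
    unfolding IP2_def is_product_of_def by blast
  have row: "axis 1 1 v* foldr (**) Es (mat 1) = A $ 1"
    by (simp add: axis_one_vector_matrix_mult flip: M)
  obtain G where G: "GE2 G" "A $ 1 = axis 1 1 v* G"
    using reducible_row_times_idempotents[OF Es is_product_of_one, of "axis 1 1" B]
    by (auto simp: row unimodular vector_matrix_mul_rid)
  obtain H where H: "G ** H = mat 1" "H ** G = mat 1"
    using GE2_inverse[OF G(1)] by blast
  have "(A ** H) ** (G ** B) = A ** (H ** G) ** B"
    by (simp only: matrix_mul_assoc)
  then have "(A ** H) ** (G ** B) = mat 1"
    by (simp add: H B)
  moreover have "(A ** H) $ 1 = (A $ 1) v* H"
    by (simp add: vector_matrix_mul_assoc flip: axis_one_vector_matrix_mult)
  then have "(A ** H) $ 1 = axis 1 1"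
    by (simp add: G(2) H vector_matrix_mul_assoc vector_matrix_mul_rid)
  ultimately have "GE2 (A ** H)"
    by (rule GE2_if_first_row_e1)
  then have "GE2 ((A ** H) ** G)"
    using G(1) by (rule is_product_of_mult)
  then show ?thesis
    by (simp add: H flip: matrix_mul_assoc)
qed

end
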